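(* Let $(W,S)$ be a finite Coxeter system and let $B(W)$ be its Bruhat graph. Then the discrete Ricci curvature of $B(W)$ equals $2$, i.e. $\mathrm{Ric}(B(W))=2$.
   Context: A Coxeter system $(W,S)$ consists of a group $W$ with finite generating set $S=\{s_i\}_{i\in I}$ and presentation $(s_is_j)^{m_{ij}}=e$, where $m_{ii}=1$ and $m_{ij}=m_{ji}\ge 2$ for $i\ne j$. The length $\ell(w)$ is the minimal length of an expression of $w$ as a product of elements of $S$. The set of reflections is $T=\bigcup_{w\in W} wSw^{-1}$. The Bruhat graph $B(W)$ is the simple undirected graph with vertex set $W$, where $w,v$ are joined by an edge iff $v=tw$ for some $t\in T$ with $\ell(v)<\ell(w)$, or $w=tv$ for some $t\in T$ with $\ell(w)<\ell(v)$. For a locally finite simple graph $G$ without isolated vertices, with graph distance $\delta$, let $B(1,x)$ be the set of neighbours of $x$. For real functions $f,g$ on the vertex set and a vertex $x$ define $\Delta(f)(x)=\sum_{v\in B(1,x)}(f(v)-f(x))$, $\Gamma(f,g)(x)=\frac12\sum_{v\in B(1,x)}(f(x)-f(v))(g(x)-g(v))$, $\Gamma(f)=\Gamma(f,f)$, and $\Gamma_2(f)(x)=\frac12\Delta(\Gamma(f,f))(x)-\Gamma(f,\Delta f)(x)$. The discrete Ricci curvature $\mathrm{Ric}(G)$ is the maximal $K\in\mathbb{R}\cup\{-\infty\}$ such that $\Gamma_2(f)(x)\ge K\,\Gamma(f)(x)$ for every real function $f$ on the vertices and every vertex $x$. *)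

theory Defs
  imports "HOL-Algebra.Generated_Groups" "HOL-Library.Extended_Real"
begin

section \<open>Group presentations\<close>

text \<open>The letter \<open>(s, True)\<close> stands for the generator \<open>s\<close> and \<open>(s, False)\<close> for its formal inverse.\<close>

type_synonym 'a gword = "('a \<times> bool) list"

abbreviation gwords :: "'a set \<Rightarrow> 'a gword set" where
  "gwords S \<equiv> lists (S \<times> UNIV)"

definition gword_eval :: "('a, 'b) monoid_scheme \<Rightarrow> 'a gword \<Rightarrow> 'a" where
  "gword_eval G u = foldr (\<lambda>(s, e) x. (if e then s else inv\<^bsub>G\<^esub> s) \<otimes>\<^bsub>G\<^esub> x) u \<one>\<^bsub>G\<^esub>"

text \<open>Equality of words in the group \<open>\<langle>S | R\<rangle>\<close>, that is, in the free group on \<open>S\<close> modulo the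
  normal closure of the relators \<open>R\<close>.\<close>

inductive pres_eq :: "'a set \<Rightarrow> 'a gword set \<Rightarrow> 'a gword \<Rightarrow> 'a gword \<Rightarrow> bool"
  for S :: "'a set" and R :: "'a gword set" where
  refl: "u \<in> gwords S \<Longrightarrow> pres_eq S R u u"
| sym: "pres_eq S R u v \<Longrightarrow> pres_eq S R v u"
| trans: "pres_eq S R u v \<Longrightarrow> pres_eq S R v w \<Longrightarrow> pres_eq S R u w"
| cancel: "u \<in> gwords S \<Longrightarrow> v \<in> gwords S \<Longrightarrow> s \<in> S \<Longrightarrow>
    pres_eq S R (u @ [(s, e), (s, \<not> e)] @ v) (u @ v)"
| relator: "u \<in> gwords S \<Longrightarrow> v \<in> gwords S \<Longrightarrow> r \<in> R \<Longrightarrow>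
    pres_eq S R (u @ r @ v) (u @ v)"

text \<open>The canonical map from \<open>\<langle>S | R\<rangle>\<close> to \<open>G\<close> is well defined, injective and surjective.\<close>

definition has_presentation :: "('a, 'b) monoid_scheme \<Rightarrow> 'a set \<Rightarrow> 'a gword set \<Rightarrow> bool" where
  "has_presentation G S R \<longleftrightarrow>
     S \<subseteq> carrier G \<and> R \<subseteq> gwords S \<and> generate G S = carrier G \<and>
     (\<forall>u \<in> gwords S. \<forall>v \<in> gwords S. gword_eval G u = gword_eval G v \<longleftrightarrow> pres_eq S R u v)"

section \<open>Coxeter systems\<close>

text \<open>The index set is \<open>S\<close> itself. The entry \<open>\<infinity>\<close> means that there is no relation between the two
  generators.\<close>

definition coxeter_matrix :: "'a set \<Rightarrow> ('a \<Rightarrow> 'a \<Rightarrow> enat) \<Rightarrow> bool" where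
  "coxeter_matrix S m \<longleftrightarrow>
     (\<forall>s \<in> S. m s s = 1) \<and>
     (\<forall>s \<in> S. \<forall>t \<in> S. s \<noteq> t \<longrightarrow> m s t = m t s \<and> 2 \<le> m s t)"

definition coxeter_relators :: "'a set \<Rightarrow> ('a \<Rightarrow> 'a \<Rightarrow> enat) \<Rightarrow> 'a gword set" where
  "coxeter_relators S m =
     {concat (replicate n [(s, True), (t, True)]) | s t n. s \<in> S \<and> t \<in> S \<and> m s t = enat n}"

definition coxeter_system :: "('a, 'b) monoid_scheme \<Rightarrow> 'a set \<Rightarrow> bool" where
  "coxeter_system W S \<longleftrightarrow>
     group W \<and> finite S \<and>
     (\<exists>m. coxeter_matrix S m \<and> has_presentation W S (coxeter_relators S m))"

definition cox_length :: "('a, 'b) monoid_scheme \<Rightarrow> 'a set \<Rightarrow> 'a \<Rightarrow> nat" where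
  "cox_length W S w =
     (LEAST n. \<exists>us \<in> lists S. length us = n \<and> foldr (\<otimes>\<^bsub>W\<^esub>) us \<one>\<^bsub>W\<^esub> = w)"

definition reflections :: "('a, 'b) monoid_scheme \<Rightarrow> 'a set \<Rightarrow> 'a set" where
  "reflections W S = (\<Union>w \<in> carrier W. {w \<otimes>\<^bsub>W\<^esub> s \<otimes>\<^bsub>W\<^esub> inv\<^bsub>W\<^esub> w | s. s \<in> S})"

definition bruhat_edges :: "('a, 'b) monoid_scheme \<Rightarrow> 'a set \<Rightarrow> 'a set set" where
  "bruhat_edges W S =
     {{w, v} | w v. w \<in> carrier W \<and> v \<in> carrier W \<and>
        ((\<exists>t \<in> reflections W S. v = t \<otimes>\<^bsub>W\<^esub> w \<and> cox_length W S v < cox_length W S w) \<or>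
         (\<exists>t \<in> reflections W S. w = t \<otimes>\<^bsub>W\<^esub> v \<and> cox_length W S w < cox_length W S v))}"

section \<open>Discrete Ricci curvature\<close>

text \<open>A simple graph is given by its vertex set \<open>V\<close> and a set \<open>E\<close> of two-element subsets of \<open>V\<close>.
  The definitions are meant for locally finite graphs without isolated vertices. Functions on the
  vertices are total; their values outside \<open>V\<close> play no role.\<close>

definition nbrs :: "'a set set \<Rightarrow> 'a \<Rightarrow> 'a set" where
  "nbrs E x = {v. {x, v} \<in> E}"

definition graph_laplacian :: "'a set set \<Rightarrow> ('a \<Rightarrow> real) \<Rightarrow> 'a \<Rightarrow> real" where
  "graph_laplacian E f x = (\<Sum>v \<in> nbrs E x. f v - f x)"

definition graph_Gamma :: "'a set set \<Rightarrow> ('a \<Rightarrow> real) \<Rightarrow> ('a \<Rightarrow> real) \<Rightarrow> 'a \<Rightarrow> real" where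
  "graph_Gamma E f g x = 1/2 * (\<Sum>v \<in> nbrs E x. (f x - f v) * (g x - g v))"

definition graph_Gamma2 :: "'a set set \<Rightarrow> ('a \<Rightarrow> real) \<Rightarrow> 'a \<Rightarrow> real" where
  "graph_Gamma2 E f x =
     1/2 * graph_laplacian E (graph_Gamma E f f) x - graph_Gamma E f (graph_laplacian E f) x"

text \<open>The value \<open>K = -\<infinity>\<close> is always admissible: if \<open>\<Gamma>(f)(x) = 0\<close>, then \<open>f\<close> is constant on \<open>x\<close> and its
  neighbours, so \<open>\<Gamma>\<^sub>2(f)(x) \<ge> 0\<close>, which agrees with the convention \<open>-\<infinity> * 0 = 0\<close> of \<open>ereal\<close>.\<close>

definition ricci_bound :: "'a set \<Rightarrow> 'a set set \<Rightarrow> ereal \<Rightarrow> bool" where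
  "ricci_bound V E K \<longleftrightarrow> K \<noteq> \<infinity> \<and>
     (\<forall>f :: 'a \<Rightarrow> real. \<forall>x \<in> V.
        ereal (graph_Gamma2 E f x) \<ge> K * ereal (graph_Gamma E f f x))"

definition ricci_curvature :: "'a set \<Rightarrow> 'a set set \<Rightarrow> ereal" where
  "ricci_curvature V E = (GREATEST K. ricci_bound V E K)"

end

theory Submission
  imports Defs
begin

text \<open>By parity of the length, \<open>B(W)\<close> is the Cayley graph of \<open>W\<close> with respect to the reflections
  \<open>T\<close>, which are involutions closed under conjugation. Substituting \<open>(s, t) \<mapsto> (sts, s)\<close>, which keeps
  the product \<open>st\<close>, turns \<open>\<Gamma>\<^sub>2\<close> into a sum of squares:
  \<open>4 \<Gamma>\<^sub>2(f)(x) = (\<Sum>s t. (f(stx) - f(sx) - f(tx) + f(x))\<^sup>2)\<close>. The diagonal terms \<open>s = t\<close> sum to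
  \<open>8 \<Gamma>(f)(x)\<close>, so \<open>\<Gamma>\<^sub>2 \<ge> 2 \<Gamma>\<close>. At \<open>x = \<one>\<close> the off-diagonal terms vanish for the function with
  value 0 at \<open>\<one>\<close>, 1 on \<open>T\<close> and 2 elsewhere, because a product of two reflections is never a
  reflection.\<close>

section \<open>Curvature of Cayley graphs of conjugation-invariant sets of involutions\<close>

text \<open>Of the edge set only the neighbourhoods matter, since all curvature operators are built
  from sums over them.\<close>

locale involution_cayley = group G for G :: "('a, 'b) monoid_scheme" (structure) +
  fixes T :: "'a set" and E :: "'a set set"
  assumes finT: "finite T"
    and T_carrier: "T \<subseteq> carrier G"
    and T_involution: "t \<in> T \<Longrightarrow> t \<otimes> t = \<one>"
    and T_conj: "s \<in> T \<Longrightarrow> t \<in> T \<Longrightarrow> s \<otimes> t \<otimes> s \<in> T"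
    and nbrs_eq: "x \<in> carrier G \<Longrightarrow> nbrs E x = (\<lambda>t. t \<otimes> x) ` T"
begin

section \<open>Sums over neighbours as sums over \<open>T\<close>\<close>

lemma T_closed [simp]: "t \<in> T \<Longrightarrow> t \<in> carrier G"
  using T_carrier by blast

lemma T_cancel [simp]:
  assumes "t \<in> T" "x \<in> carrier G"
  shows "t \<otimes> (t \<otimes> x) = x"
  using assms by (simp add: m_assoc [symmetric] T_involution)

lemma sum_nbrs:
  assumes "x \<in> carrier G"
  shows "sum h (nbrs E x) = (\<Sum>t\<in>T. h (t \<otimes> x))"
proof -
  have "inj_on (\<lambda>t. t \<otimes> x) T"
    using assms by (auto intro: inj_onI)
  then show ?thesis
    using assms by (simp add: nbrs_eq sum.reindex)
qed

lemma Gamma_eq: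
  assumes "x \<in> carrier G"
  shows "graph_Gamma E f f x = (\<Sum>t\<in>T. (f (t \<otimes> x) - f x)\<^sup>2) / 2"
  using assms by (simp add: graph_Gamma_def sum_nbrs power2_eq_square algebra_simps)

text \<open>This is the Hurwitz move on pairs with a given product: \<open>sts * s = st\<close>, and
  \<open>(s, t) \<mapsto> (t, tst)\<close> undoes it.\<close>

lemma bij_betw_conj_swap: "bij_betw (\<lambda>(s, t). (s \<otimes> t \<otimes> s, s)) (T \<times> T) (T \<times> T)"
proof (rule bij_betw_byWitness [where f' = "\<lambda>(s, t). (t, t \<otimes> s \<otimes> t)"])
qed (use T_conj in \<open>auto simp: m_assoc T_involution\<close>)

text \<open>Closure of \<open>T\<close> under conjugation enters \<open>Gamma2_eq\<close> here: it
  equates the two mixed sums needed for completing the square.\<close>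

lemma sum_conj_swap:
  fixes h :: "'a \<Rightarrow> 'a \<Rightarrow> real"
  shows "(\<Sum>s\<in>T. \<Sum>t\<in>T. h (s \<otimes> t) s) = (\<Sum>s\<in>T. \<Sum>t\<in>T. h (s \<otimes> t) t)"
proof -
  have "(\<Sum>s\<in>T. \<Sum>t\<in>T. h (s \<otimes> t) t) = (\<Sum>(s, t)\<in>T \<times> T. h (s \<otimes> t) t)"
    by (simp add: sum.cartesian_product)
  also have "\<dots> = (\<Sum>p\<in>T \<times> T. case (case p of (s, t) \<Rightarrow> (s \<otimes> t \<otimes> s, s)) of (s, t) \<Rightarrow> h (s \<otimes> t) t)"
    by (rule sum.reindex_bij_betw [OF bij_betw_conj_swap, symmetric])
  also have "\<dots> = (\<Sum>(s, t)\<in>T \<times> T. h (s \<otimes> t) s)"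
    by (rule sum.cong) (auto simp: m_assoc T_involution)
  finally show ?thesis
    by (simp add: sum.cartesian_product)
qed

theorem Gamma2_eq:
  assumes x: "x \<in> carrier G"
  shows "graph_Gamma2 E f x =
    (\<Sum>s\<in>T. \<Sum>t\<in>T. (f (s \<otimes> t \<otimes> x) - f (s \<otimes> x) - f (t \<otimes> x) + f x)\<^sup>2) / 4"
proof -
  \<comment> \<open>\<open>a\<close> and \<open>b\<close> have the same body; the two names separate
    values at neighbours of \<open>x\<close> from values at points
    \<open>s \<otimes> t \<otimes> x\<close> reached in two steps.\<close>
  define a where "a t = f (t \<otimes> x) - f x" for t
  define b where "b w = f (w \<otimes> x) - f x" for w
  let ?S = "\<lambda>h :: 'a \<Rightarrow> 'a \<Rightarrow> real. \<Sum>s\<in>T. \<Sum>t\<in>T. h s t"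
  have ab: "f (s \<otimes> (t \<otimes> x)) - f (t \<otimes> x) = b (s \<otimes> t) - a t" if "s \<in> T" "t \<in> T" for s t
    using that x by (simp add: a_def b_def m_assoc)
  have Ga: "graph_Gamma E f f x = (\<Sum>s\<in>T. (a s)\<^sup>2) / 2"
    using x by (simp add: Gamma_eq a_def)
  have La: "graph_laplacian E f x = (\<Sum>s\<in>T. a s)"
    using x by (simp add: graph_laplacian_def sum_nbrs a_def)
  have Gb: "graph_Gamma E f f (t \<otimes> x) = (\<Sum>s\<in>T. (b (s \<otimes> t) - a t)\<^sup>2) / 2" if "t \<in> T" for t
    using x that by (simp add: Gamma_eq ab)
  have Lb: "graph_laplacian E f (t \<otimes> x) = (\<Sum>s\<in>T. b (s \<otimes> t) - a t)" if "t \<in> T" for t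
    using x that by (simp add: graph_laplacian_def sum_nbrs ab)
  have "graph_laplacian E (graph_Gamma E f f) x =
      (\<Sum>t\<in>T. \<Sum>s\<in>T. ((b (s \<otimes> t) - a t)\<^sup>2 - (a s)\<^sup>2) / 2)"
    unfolding graph_laplacian_def sum_nbrs [OF x]
    by (simp add: Gb Ga sum_subtractf sum_divide_distrib diff_divide_distrib)
  then have L: "graph_laplacian E (graph_Gamma E f f) x =
      ?S (\<lambda>s t. ((b (s \<otimes> t) - a t)\<^sup>2 - (a s)\<^sup>2) / 2)"
    by (subst sum.swap)
  have "graph_Gamma E f (graph_laplacian E f) x =
      (\<Sum>t\<in>T. a t * (graph_laplacian E f (t \<otimes> x) - graph_laplacian E f x)) / 2"
    using x by (simp add: graph_Gamma_def sum_nbrs a_def algebra_simps)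
  also have "\<dots> = (\<Sum>t\<in>T. \<Sum>s\<in>T. a t * (b (s \<otimes> t) - a t - a s)) / 2"
    by (simp add: Lb La sum_subtractf [symmetric] sum_distrib_left)
  also have "\<dots> = ?S (\<lambda>s t. a t * (b (s \<otimes> t) - a t - a s)) / 2"
    by (subst sum.swap) simp
  finally have G: "graph_Gamma E f (graph_laplacian E f) x =
      ?S (\<lambda>s t. a t * (b (s \<otimes> t) - a t - a s)) / 2" .
  have sq: "?S (\<lambda>s t. (a s)\<^sup>2) = ?S (\<lambda>s t. (a t)\<^sup>2)"
    by (rule sum.swap)
  have ba: "?S (\<lambda>s t. b (s \<otimes> t) * a s) = ?S (\<lambda>s t. b (s \<otimes> t) * a t)"
    by (rule sum_conj_swap)
  \<comment> \<open>The factor 4 clears the halves in \<Gamma> and \<Gamma>2.\<close>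
  have "4 * graph_Gamma2 E f x =
      ?S (\<lambda>s t. ((b (s \<otimes> t) - a t)\<^sup>2 - (a s)\<^sup>2) - 2 * (a t * (b (s \<otimes> t) - a t - a s)))"
    unfolding graph_Gamma2_def L G
    by (simp only: sum_subtractf sum_distrib_left [symmetric] sum_divide_distrib [symmetric]) simp
  also have "\<dots> = ?S (\<lambda>s t. (b (s \<otimes> t))\<^sup>2 + 3 * (a t)\<^sup>2 - (a s)\<^sup>2 + 2 * (a s * a t)
      - 4 * (b (s \<otimes> t) * a t))"
    by (intro sum.cong refl) (simp_all add: power2_eq_square algebra_simps)
  \<comment> \<open>Only the double sums agree, not the summands: \<open>sq\<close> replaces
    \<open>3 (a t)^2 - (a s)^2\<close> by \<open>(a s)^2 + (a t)^2\<close>, and \<open>ba\<close>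
    moves two of the four mixed terms from \<open>t\<close> to \<open>s\<close>.\<close>
  also have "\<dots> = ?S (\<lambda>s t. (b (s \<otimes> t))\<^sup>2 + (a s)\<^sup>2 + (a t)\<^sup>2 + 2 * (a s * a t)
      - 2 * (b (s \<otimes> t) * a s) - 2 * (b (s \<otimes> t) * a t))"
    by (simp only: sum_subtractf sum.distrib sum_distrib_left [symmetric] sq ba)
  also have "\<dots> = ?S (\<lambda>s t. (b (s \<otimes> t) - a s - a t)\<^sup>2)"
    by (intro sum.cong refl) (simp_all add: power2_eq_square algebra_simps)
  also have "\<dots> = ?S (\<lambda>s t. (f (s \<otimes> t \<otimes> x) - f (s \<otimes> x) - f (t \<otimes> x) + f x)\<^sup>2)"
    by (intro sum.cong refl) (simp_all add: a_def b_def algebra_simps)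
  finally show ?thesis
    by simp
qed

text \<open>For \<open>s = t\<close> the product \<open>s \<otimes> t\<close> is
  \<open>\<one>\<close> and the square is \<open>4 (f (s \<otimes> x) - f x)^2\<close>; this is the
  source of the constant 2. The remainder is nonnegative, and sharpness requires it to vanish for
  some \<open>f\<close>.\<close>

lemma Gamma2_diag:
  assumes x: "x \<in> carrier G"
  shows "graph_Gamma2 E f x = 2 * graph_Gamma E f f x +
    (\<Sum>s\<in>T. \<Sum>t\<in>T - {s}. (f (s \<otimes> t \<otimes> x) - f (s \<otimes> x) - f (t \<otimes> x) + f x)\<^sup>2) / 4"
proof -
  have "(\<Sum>t\<in>T. (f (s \<otimes> t \<otimes> x) - f (s \<otimes> x) - f (t \<otimes> x) + f x)\<^sup>2) =
      4 * (f (s \<otimes> x) - f x)\<^sup>2 +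
      (\<Sum>t\<in>T - {s}. (f (s \<otimes> t \<otimes> x) - f (s \<otimes> x) - f (t \<otimes> x) + f x)\<^sup>2)" if "s \<in> T" for s
    using that x
    by (simp add: sum.remove [OF finT that] T_involution power2_eq_square algebra_simps)
  then show ?thesis
    using x by (simp add: Gamma2_eq Gamma_eq sum.distrib sum_distrib_left [symmetric])
qed

section \<open>The bound 2 and its sharpness\<close>

lemma ricci_bound_two: "ricci_bound (carrier G) E 2"
proof -
  have "2 * graph_Gamma E f f x \<le> graph_Gamma2 E f x" if "x \<in> carrier G" for f x
    unfolding Gamma2_diag [OF that] by (simp add: sum_nonneg)
  then have "ereal 2 * ereal (graph_Gamma E f f x) \<le> ereal (graph_Gamma2 E f x)"
    if "x \<in> carrier G" for f x
    using that by simp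
  then show ?thesis
    by (simp add: ricci_bound_def)
qed

lemma ricci_bound_le_two:
  assumes "T \<noteq> {}" "\<one> \<notin> T" "\<And>s t. s \<in> T \<Longrightarrow> t \<in> T \<Longrightarrow> s \<otimes> t \<notin> T"
    and K: "ricci_bound (carrier G) E K"
  shows "K \<le> 2"
proof -
  \<comment> \<open>Graph distance from \<open>\<one>\<close>, truncated at 2: the off-diagonal
    squares at \<open>\<one>\<close> become \<open>(2 - 1 - 1 + 0)^2\<close>.\<close>
  define f :: "'a \<Rightarrow> real" where "f w = (if w = \<one> then 0 else if w \<in> T then 1 else 2)" for w
  have fT: "f t = 1" if "t \<in> T" for t
    using that assms by (auto simp: f_def)
  have fTT: "f (s \<otimes> t) = 2" if "s \<in> T" "t \<in> T" "s \<noteq> t" for s t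
  proof -
    have "s \<otimes> t \<noteq> \<one>"
      using that by (metis T_cancel T_closed r_one)
    then show ?thesis
      using that assms by (simp add: f_def)
  qed
  have "(\<Sum>s\<in>T. \<Sum>t\<in>T - {s}. (f (s \<otimes> t \<otimes> \<one>) - f (s \<otimes> \<one>) - f (t \<otimes> \<one>) + f \<one>)\<^sup>2) = 0"
    by (intro sum.neutral ballI) (auto simp: fT fTT f_def [of \<one>])
  then have "graph_Gamma2 E f \<one> = 2 * graph_Gamma E f f \<one>"
    using Gamma2_diag [of \<one> f] by simp
  \<comment> \<open>The value is half the number of elements of \<open>T\<close>; as it is positive,
    a real \<open>K\<close> can be compared with 2 by division.\<close>
  moreover have "graph_Gamma E f f \<one> > 0"
    using assms finT by (simp add: Gamma_eq fT f_def [of \<one>] card_gt_0_iff)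
  moreover have "K * ereal (graph_Gamma E f f \<one>) \<le> ereal (graph_Gamma2 E f \<one>)"
    using K by (simp add: ricci_bound_def)
  moreover have "K \<noteq> \<infinity>"
    using K by (simp add: ricci_bound_def)
  ultimately show ?thesis
    by (cases K) auto
qed

theorem ricci_curvature_eq_two:
  assumes "T \<noteq> {}" "\<one> \<notin> T" "\<And>s t. s \<in> T \<Longrightarrow> t \<in> T \<Longrightarrow> s \<otimes> t \<notin> T"
  shows "ricci_curvature (carrier G) E = 2"
  unfolding ricci_curvature_def
  by (rule Greatest_equality) (use ricci_bound_two ricci_bound_le_two assms in auto)

end

section \<open>Parity of the length in a Coxeter group\<close>

text \<open>Each basic rule deletes a subword of even length, so parity is an invariant of the
  class; this is the sign character.\<close>

lemma pres_eq_even_length: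
  assumes "pres_eq S R u v" "\<And>r. r \<in> R \<Longrightarrow> even (length r)"
  shows "even (length u) \<longleftrightarrow> even (length v)"
  using assms by (induction rule: pres_eq.induct) auto

locale coxeter_group = group W for W :: "('a, 'b) monoid_scheme" (structure) +
  fixes S :: "'a set"
  assumes coxeter: "coxeter_system W S"
begin

section \<open>Words in the generators and parity of the length\<close>

lemma rev_in_lists [simp]: "rev us \<in> lists S \<longleftrightarrow> us \<in> lists S"
  by (simp add: in_lists_conv_set)

text \<open>The product that occurs inside \<open>cox_length\<close>. Words without formal inverses
  suffice because generators are involutions.\<close>

definition word_prod :: "'a list \<Rightarrow> 'a" where
  "word_prod us = foldr (\<otimes>) us \<one>"

lemma word_prod_simps [simp]:
  "word_prod [] = \<one>"
  "word_prod (u # us) = u \<otimes> word_prod us"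
  by (simp_all add: word_prod_def)

lemma presentation:
  obtains m where "coxeter_matrix S m" "has_presentation W S (coxeter_relators S m)"
  using coxeter unfolding coxeter_system_def by blast

lemma S_closed [simp]: "s \<in> S \<Longrightarrow> s \<in> carrier W"
  by (rule presentation) (auto simp: has_presentation_def)

lemma word_prod_closed [simp]: "us \<in> lists S \<Longrightarrow> word_prod us \<in> carrier W"
  by (induction us) auto

lemma word_prod_append:
  "us \<in> lists S \<Longrightarrow> vs \<in> lists S \<Longrightarrow> word_prod (us @ vs) = word_prod us \<otimes> word_prod vs"
  by (induction us) (auto simp: m_assoc)

text \<open>The diagonal entry \<open>m s s = 1\<close> makes the word \<open>ss\<close> itself a
  relator.\<close>

lemma S_involution:
  assumes "s \<in> S"
  shows "s \<otimes> s = \<one>"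
proof -
  obtain m where m: "coxeter_matrix S m" "has_presentation W S (coxeter_relators S m)"
    by (rule presentation)
  have "m s s = enat 1"
    using m assms by (auto simp: coxeter_matrix_def one_enat_def)
  moreover have "[(s, True), (s, True)] = concat (replicate 1 [(s, True), (s, True)])"
    by simp
  ultimately have "[(s, True), (s, True)] \<in> coxeter_relators S m"
    using assms unfolding coxeter_relators_def by blast
  then have "pres_eq S (coxeter_relators S m) ([] @ [(s, True), (s, True)] @ []) ([] @ [])"
    by (intro pres_eq.relator) auto
  then have "gword_eval W [(s, True), (s, True)] = gword_eval W []"
    using m assms by (auto simp: has_presentation_def)
  then show ?thesis
    using assms by (simp add: gword_eval_def)
qed

lemma inv_S: "s \<in> S \<Longrightarrow> inv s = s"
  by (simp add: inv_equality S_involution)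

lemma inv_word_prod: "us \<in> lists S \<Longrightarrow> inv (word_prod us) = word_prod (rev us)"
proof (induction us)
  case (Cons u us)
  then show ?case
    using word_prod_append [of "rev us" "[u]"] by (simp add: inv_mult_group inv_S)
qed simp

lemma word_prod_surj:
  assumes "w \<in> carrier W"
  obtains us where "us \<in> lists S" "word_prod us = w"
proof -
  have "w \<in> generate W S"
    by (rule presentation) (use assms in \<open>simp add: has_presentation_def\<close>)
  then have "\<exists>us\<in>lists S. word_prod us = w"
  proof (induction rule: generate.induct)
    case one
    show ?case by (rule bexI [of _ "[]"]) auto
  next
    case (incl s)
    then show ?case by (intro bexI [of _ "[s]"]) auto
  next
    case (inv s)
    then show ?case by (intro bexI [of _ "[s]"]) (auto simp: inv_S)
  next
    case (eng x y)
    then obtain us vs where "us \<in> lists S" "word_prod us = x" "vs \<in> lists S" "word_prod vs = y"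
      by blast
    then show ?case
      by (intro bexI [of _ "us @ vs"]) (auto simp: word_prod_append)
  qed
  then show ?thesis
    using that by blast
qed

text \<open>The injectivity half of the presentation is used: words with equal products are linked
  by cancellations and relators \<open>(st)^n\<close>, the latter of length
  \<open>2n\<close>.\<close>

lemma word_prod_parity:
  assumes "us \<in> lists S" "vs \<in> lists S" "word_prod us = word_prod vs"
  shows "even (length us) \<longleftrightarrow> even (length vs)"
proof -
  obtain m where m: "coxeter_matrix S m" "has_presentation W S (coxeter_relators S m)"
    by (rule presentation)
  let ?pos = "map (\<lambda>s. (s, True)) :: 'a list \<Rightarrow> 'a gword"
  have "gword_eval W (?pos us) = word_prod us" for us
    by (induction us) (auto simp: gword_eval_def)
  moreover have "?pos us \<in> gwords S" if "us \<in> lists S" for us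
    using that by auto
  ultimately have "pres_eq S (coxeter_relators S m) (?pos us) (?pos vs)"
    using m assms unfolding has_presentation_def by metis
  moreover have "even (length r)" if "r \<in> coxeter_relators S m" for r
    using that by (auto simp: coxeter_relators_def length_concat sum_list_replicate)
  ultimately show ?thesis
    using pres_eq_even_length by fastforce
qed

text \<open>A word of minimal length has the same product, so \<open>word_prod_parity\<close>
  applies to it.\<close>

lemma cox_length_parity:
  assumes "us \<in> lists S"
  shows "even (cox_length W S (word_prod us)) \<longleftrightarrow> even (length us)"
proof -
  have "\<exists>vs\<in>lists S. length vs = cox_length W S (word_prod us) \<and> word_prod vs = word_prod us"
    unfolding cox_length_def word_prod_def by (rule LeastI_ex) (use assms in blast)
  then show ?thesis
    using word_prod_parity assms by metis
qed

text \<open>Lengths of words add under concatenation, so parity is a homomorphism to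
  \<open>Z/2\<close>.\<close>

lemma even_cox_length_mult:
  assumes "v \<in> carrier W" "w \<in> carrier W"
  shows "even (cox_length W S (v \<otimes> w)) \<longleftrightarrow> (even (cox_length W S v) \<longleftrightarrow> even (cox_length W S w))"
proof -
  obtain us vs where "us \<in> lists S" "word_prod us = v" "vs \<in> lists S" "word_prod vs = w"
    using assms by (metis word_prod_surj)
  then show ?thesis
    using cox_length_parity [of us] cox_length_parity [of vs] cox_length_parity [of "us @ vs"]
    by (auto simp: word_prod_append)
qed

section \<open>Reflections as palindromic words\<close>

lemma reflection_word:
  assumes "t \<in> reflections W S"
  obtains us s where "us \<in> lists S" "s \<in> S" "t = word_prod (us @ [s] @ rev us)"
proof -
  obtain w s where w: "w \<in> carrier W" "s \<in> S" "t = w \<otimes> s \<otimes> inv w"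
    using assms by (auto simp: reflections_def)
  obtain us where "us \<in> lists S" "word_prod us = w"
    using w word_prod_surj by metis
  then show ?thesis
    using w that [of us s] word_prod_append [of us "[s] @ rev us"]
    by (auto simp: inv_word_prod [symmetric] m_assoc)
qed

lemma reflection_closed: "t \<in> reflections W S \<Longrightarrow> t \<in> carrier W"
  by (auto simp: reflections_def)

text \<open>The palindrome has length \<open>2 * length us + 1\<close>.\<close>

lemma odd_cox_length_reflection: "t \<in> reflections W S \<Longrightarrow> odd (cox_length W S t)"
  by (erule reflection_word) (simp add: cox_length_parity )

text \<open>Inversion reverses words in involutions and so fixes a palindrome.\<close>

lemma reflection_involution:
  assumes "t \<in> reflections W S"
  shows "t \<otimes> t = \<one>"
proof -
  obtain us s where "us \<in> lists S" "s \<in> S" "t = word_prod (us @ [s] @ rev us)"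
    using assms by (rule reflection_word)
  then have "inv t = t"
    using inv_word_prod [of "us @ [s] @ rev us"] by simp
  then show ?thesis
    using assms by (metis reflection_closed r_inv)
qed

lemma reflection_conj:
  assumes "t \<in> reflections W S" "x \<in> carrier W"
  shows "x \<otimes> t \<otimes> inv x \<in> reflections W S"
proof -
  obtain w s where w: "w \<in> carrier W" "s \<in> S" "t = w \<otimes> s \<otimes> inv w"
    using assms by (auto simp: reflections_def)
  then have "x \<otimes> t \<otimes> inv x = (x \<otimes> w) \<otimes> s \<otimes> inv (x \<otimes> w)"
    using assms by (simp add: m_assoc inv_mult_group)
  then show ?thesis
    using w assms unfolding reflections_def by blast
qed

section \<open>The Bruhat graph as a Cayley graph\<close>

lemma cox_length_reflection_mult_neq:
  assumes "t \<in> reflections W S" "x \<in> carrier W"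
  shows "cox_length W S (t \<otimes> x) \<noteq> cox_length W S x"
  using even_cox_length_mult [of t x] odd_cox_length_reflection [of t] reflection_closed assms
  by metis

text \<open>Multiplication by a reflection flips the parity of the length, so \<open>x\<close> and
  \<open>t \<otimes> x\<close> always compare strictly and every reflection yields an edge at
  \<open>x\<close>.\<close>

lemma nbrs_bruhat:
  assumes x: "x \<in> carrier W"
  shows "nbrs (bruhat_edges W S) x = (\<lambda>t. t \<otimes> x) ` reflections W S"
proof (intro equalityI subsetI)
  \<comment> \<open>Since \<open>t\<close> is its own inverse, the two alternatives in
    \<open>bruhat_edges\<close> give the same neighbours.\<close>
  have swap: "v = t \<otimes> w" if "t \<in> reflections W S" "w = t \<otimes> v" "v \<in> carrier W" for t v w
    using that by (simp add: m_assoc [symmetric] reflection_closed reflection_involution)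
  fix v
  assume "v \<in> nbrs (bruhat_edges W S) x"
  then show "v \<in> (\<lambda>t. t \<otimes> x) ` reflections W S"
    unfolding nbrs_def bruhat_edges_def
    by (auto simp: doubleton_eq_iff dest: swap)
next
  fix v
  assume "v \<in> (\<lambda>t. t \<otimes> x) ` reflections W S"
  then obtain t where t: "t \<in> reflections W S" "v = t \<otimes> x"
    by blast
  then have v: "v \<in> carrier W" "x = t \<otimes> v"
    using x by (simp_all add: m_assoc [symmetric] reflection_closed reflection_involution)
  have "cox_length W S v < cox_length W S x \<or> cox_length W S x < cox_length W S v"
    using cox_length_reflection_mult_neq t x by (metis nat_neq_iff)
  then show "v \<in> nbrs (bruhat_edges W S) x"
    using x t v unfolding nbrs_def bruhat_edges_def by blast
qed

lemma involution_cayley_bruhat: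
  assumes "finite (carrier W)"
  shows "involution_cayley W (reflections W S) (bruhat_edges W S)"
proof
  show "finite (reflections W S)"
    using assms reflection_closed by (meson finite_subset subsetI)
  show "s \<otimes> t \<otimes> s \<in> reflections W S" if "s \<in> reflections W S" "t \<in> reflections W S" for s t
  proof -
    have "inv s = s"
      using that by (simp add: inv_equality reflection_closed reflection_involution)
    then show ?thesis
      using that reflection_conj [of t s] by (simp add: reflection_closed)
  qed
qed (auto simp: reflection_closed reflection_involution nbrs_bruhat)

lemma reflections_nonempty:
  assumes "S \<noteq> {}"
  shows "reflections W S \<noteq> {}"
  using assms unfolding reflections_def by blast

lemma one_not_reflection: "\<one> \<notin> reflections W S"
  using cox_length_reflection_mult_neq [of \<one> \<one>] by auto

text \<open>Two elements of odd length have a product of even length.\<close>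

lemma reflection_mult_not_reflection:
  assumes "s \<in> reflections W S" "t \<in> reflections W S"
  shows "s \<otimes> t \<notin> reflections W S"
  using assms even_cox_length_mult odd_cox_length_reflection reflection_closed by metis

end

text \<open>\<open>S \<noteq> {}\<close> rules out the one-vertex graph, whose vertex is isolated
  and where every \<open>K < \<infinity>\<close> is admissible.\<close>

theorem theorem3p1:
  fixes W :: "('a, 'b) monoid_scheme" and S :: "'a set"
  assumes "coxeter_system W S"
    and "finite (carrier W)"
    and "S \<noteq> {}"
  shows "ricci_curvature (carrier W) (bruhat_edges W S) = 2"
proof -
  interpret coxeter_group W S
    using assms by (simp add: coxeter_group_def coxeter_group_axioms_def coxeter_system_def)
  interpret involution_cayley W "reflections W S" "bruhat_edges W S"
    using assms by (intro involution_cayley_bruhat)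
  show ?thesis
    using assms
    by (intro ricci_curvature_eq_two reflections_nonempty one_not_reflection
        reflection_mult_not_reflection)
qed

end
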